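(* Let $X$ and $Y$ be topological linear spaces and $T\in LR(X,Y)$. Then $T$ is closable if and only if $T$ has a closed extension; that is, there exists a closed linear subspace $S$ of $X\times Y$ such that $D(T)\subset D(S)$ and $S(x)=T(x)$ for all $x\in D(T)$.
   Context: $X$ and $Y$ are over the same scalar field. $LR(X,Y)$ is the set of all linear subspaces of $X\times Y$. For $T\in LR(X,Y)$: $D(T)$ is its domain, $T(x)=\{y\in Y:(x,y)\in T\}$. $\overline T$ is the closure of $T$ in $X\times Y$ (product topology); $T$ is closed if $\overline T=T$, and closable if $\overline T(x)=T(x)$ for each $x\in D(T)$. *)

theory Defs
  imports "HOL-Analysis.Analysis"
begin

(* Topological linear spaces, not assumed Hausdorff.  Continuity of addition is part of the
   sort topological_ab_group_add; its continuity of negation is no extra restriction, since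
   -x = (-1)x.  The scalars form an arbitrary field whose ring operations are continuous,
   e.g. the real or the complex numbers. *)
locale topological_vector_space = vector_space scale
  for scale ::
    "'k :: {field, topological_ab_group_add, topological_semigroup_mult} \<Rightarrow>
     'x :: topological_ab_group_add \<Rightarrow> 'x" +
  assumes continuous_on_scale: "continuous_on UNIV (\<lambda>(a, x). scale a x)"

lemma topological_vector_space_scaleR:
  "topological_vector_space (scaleR :: real \<Rightarrow> 'x :: real_normed_vector \<Rightarrow> 'x)"
  by unfold_locales
     (auto simp: algebra_simps case_prod_unfold intro!: continuous_intros)

lemma topological_vector_space_complex:
  "topological_vector_space ((*) :: complex \<Rightarrow> complex \<Rightarrow> complex)"
  by unfold_locales
     (auto simp: algebra_simps case_prod_unfold intro!: continuous_intros)

(* Linear relations are sets of pairs; their domain D(T) is the library's Domain T. *)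
definition LR ::
  "('k :: field \<Rightarrow> 'x :: ab_group_add \<Rightarrow> 'x) \<Rightarrow> ('k \<Rightarrow> 'y :: ab_group_add \<Rightarrow> 'y) \<Rightarrow> ('x \<times> 'y) set set"
  where "LR sX sY = {T. module.subspace (module_prod.scale sX sY) T}"

definition rel_val :: "('x \<times> 'y) set \<Rightarrow> 'x \<Rightarrow> 'y set"
  where "rel_val T x = {y. (x, y) \<in> T}"

(* The topology on the type 'x * 'y is the product topology. *)
definition closable :: "('x :: topological_space \<times> 'y :: topological_space) set \<Rightarrow> bool"
  where "closable T \<longleftrightarrow> (\<forall>x \<in> Domain T. rel_val (closure T) x = rel_val T x)"

definition extension_of :: "('x \<times> 'y) set \<Rightarrow> ('x \<times> 'y) set \<Rightarrow> bool"
  where "extension_of S T \<longleftrightarrow>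
    Domain T \<subseteq> Domain S \<and> (\<forall>x \<in> Domain T. rel_val S x = rel_val T x)"

end

theory Submission
  imports Defs
begin

text \<open>
  The closure of a linear relation \<open>T\<close> is again a linear relation: \<open>X \<times> Y\<close> is itself a topological
  vector space (\<open>topological_vector_space_prod\<close>), and in such a space addition and scalar
  multiplication, being continuous, carry limits of elements of a subspace to limits of elements of
  that subspace (\<open>subspace_closure\<close>). Hence, if \<open>T\<close> is closable, \<open>closure T\<close> is a closed extension.

  Conversely, a relation \<open>S\<close> extending \<open>T\<close> contains \<open>T\<close>, and if it is closed it contains
  \<open>closure T\<close>. At a point \<open>x\<close> of the domain of \<open>T\<close>, the values of the closure are therefore squeezed
  between \<open>T(x)\<close> and \<open>S(x) = T(x)\<close>.
\<close>

instance prod :: (topological_monoid_add, topological_monoid_add) topological_monoid_add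
proof
  fix a b :: "'a \<times> 'b"
  have "((\<lambda>x. (fst (fst x) + fst (snd x), snd (fst x) + snd (snd x)))
          \<longlongrightarrow> (fst a + fst b, snd a + snd b)) (nhds (a, b))"
    by (auto intro!: tendsto_eq_intros filterlim_ident)
  then show "LIM x (nhds a \<times>\<^sub>F nhds b). fst x + snd x :> nhds (a + b)"
    by (simp add: nhds_prod plus_prod_def)
qed

instance prod :: (topological_group_add, topological_group_add) topological_group_add
proof
  fix a :: "'a \<times> 'b"
  have "((\<lambda>x. (- fst x, - snd x)) \<longlongrightarrow> (- fst a, - snd a)) (nhds a)"
    by (auto intro!: tendsto_intros filterlim_ident)
  then show "(uminus \<longlongrightarrow> - a) (nhds a)"
    by (simp add: uminus_prod_def [abs_def])
qed

instance prod :: (topological_ab_group_add, topological_ab_group_add) topological_ab_group_add ..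

text \<open>
  A continuous map \<open>f\<close> with \<open>f ` A \<subseteq> B\<close> maps \<open>closure A\<close> into \<open>closure B\<close>. For addition take
  \<open>A = S \<times> S\<close>, whose closure is \<open>closure S \<times> closure S\<close>; for scalar multiplication each scalar is
  held fixed.
\<close>
lemma (in topological_vector_space) subspace_closure:
  assumes "subspace S"
  shows "subspace (closure S)"
proof (rule subspaceI)
  show "0 \<in> closure S"
    using subspace_0 [OF assms] closure_subset by blast
next
  fix x y
  assume "x \<in> closure S" "y \<in> closure S"
  then have "(x, y) \<in> closure (S \<times> S)"
    by (simp add: closure_Times)
  moreover have "(\<lambda>p. fst p + snd p) ` closure (S \<times> S) \<subseteq> closure S"
    by (rule image_closure_subset)
      (use subspace_add [OF assms] closure_subset [of S] in \<open>auto intro!: continuous_intros\<close>)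
  ultimately show "x + y \<in> closure S"
    by force
next
  fix c x
  assume x: "x \<in> closure S"
  have "continuous_on (closure S) (\<lambda>x. scale c x)"
    by (rule continuous_on_compose2
        [OF continuous_on_scale, of "closure S" "\<lambda>x. (c, x)", simplified])
      (intro continuous_intros)
  then have "scale c ` closure S \<subseteq> closure S"
    by (rule image_closure_subset)
      (use subspace_scale [OF assms] closure_subset [of S] in auto)
  with x show "scale c x \<in> closure S"
    by blast
qed

lemma topological_vector_space_prod:
  assumes "topological_vector_space sX" and "topological_vector_space sY"
  shows "topological_vector_space (module_prod.scale sX sY)"
proof -
  interpret X: topological_vector_space sX by fact
  interpret Y: topological_vector_space sY by fact
  interpret vector_space_prod sX sY ..
  have "continuous_on UNIV (\<lambda>q. sX (fst q) (fst (snd q)))"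
    by (rule continuous_on_compose2
        [OF X.continuous_on_scale, of UNIV "\<lambda>q. (fst q, fst (snd q))", simplified])
      (intro continuous_intros)
  moreover have "continuous_on UNIV (\<lambda>q. sY (fst q) (snd (snd q)))"
    by (rule continuous_on_compose2
        [OF Y.continuous_on_scale, of UNIV "\<lambda>q. (fst q, snd (snd q))", simplified])
      (intro continuous_intros)
  ultimately show ?thesis
    by unfold_locales (auto simp: scale_def case_prod_unfold intro: continuous_on_Pair)
qed

lemma closure_in_LR:
  assumes "topological_vector_space sX" and "topological_vector_space sY" and "T \<in> LR sX sY"
  shows "closure T \<in> LR sX sY"
  using topological_vector_space.subspace_closure
      [OF topological_vector_space_prod [OF assms(1,2)]] assms(3)
  by (simp add: LR_def)

lemma extension_of_imp_subset: "extension_of S T \<Longrightarrow> T \<subseteq> S"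
  by (fastforce simp: extension_of_def rel_val_def)

lemma closable_iff_extension_of_closure: "closable T \<longleftrightarrow> extension_of (closure T) T"
  using closure_subset by (auto simp: closable_def extension_of_def)

text \<open>
  The closure is contained in every closed relation extending \<open>T\<close>, so like any of them it can add no
  values over the domain of \<open>T\<close>.
\<close>
lemma closed_extension_imp_closable:
  assumes "closed S" and "extension_of S T"
  shows "closable T"
  unfolding closable_def
proof
  fix x
  assume "x \<in> Domain T"
  then have "rel_val S x = rel_val T x"
    using assms(2) by (simp add: extension_of_def)
  moreover have "T \<subseteq> closure T" and "closure T \<subseteq> S"
    using assms by (simp_all add: closure_subset closure_minimal extension_of_imp_subset)
  ultimately show "rel_val (closure T) x = rel_val T x"
    unfolding rel_val_def by blast
qed

theorem theorem4p5:
  fixes sX :: "'k :: {field, topological_ab_group_add, topological_semigroup_mult} \<Rightarrow>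
               'x :: topological_ab_group_add \<Rightarrow> 'x"
    and sY :: "'k \<Rightarrow> 'y :: topological_ab_group_add \<Rightarrow> 'y"
    and T :: "('x \<times> 'y) set"
  assumes "topological_vector_space sX"
    and "topological_vector_space sY"
    and "T \<in> LR sX sY"
  shows "closable T \<longleftrightarrow> (\<exists>S \<in> LR sX sY. closed S \<and> extension_of S T)"
  using closure_in_LR [OF assms] closed_extension_imp_closable closable_iff_extension_of_closure
  by blast

end
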